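(* Let $p,q\ge 0$ be integers with $n=p+q\ge 1$. a) The subspaces $$\overline{\mathbf 0},\quad \overline{\mathbf{01}},\quad \overline{\mathbf{02}},\quad \overline{\mathbf{03}}$$ of the real Clifford algebra $\mathcal{C}\!\ell^{\mathbb R}(p,q)$ are closed with respect to the operation $U,V\mapsto\{U,V\}=UV+VU$, and form subalgebras of the Clifford algebra considered with respect to this operation. b) The subspaces $$\overline{\mathbf 0},\quad \overline{\mathbf{01}},\quad \overline{\mathbf{02}},\quad \overline{\mathbf{03}},\quad \overline{\mathbf{0123}},$$ $$\overline{\mathbf{01}}\oplus i\,\overline{\mathbf{01}},\quad \overline{\mathbf{02}}\oplus i\,\overline{\mathbf{02}},\quad \overline{\mathbf{03}}\oplus i\,\overline{\mathbf{03}},$$ $$\overline{\mathbf 0}\oplus i\,\overline{\mathbf 0},\quad \overline{\mathbf 0}\oplus i\,\overline{\mathbf 1},\quad \overline{\mathbf 0}\oplus i\,\overline{\mathbf 2},\quad \overline{\mathbf 0}\oplus i\,\overline{\mathbf 3},$$ $$\overline{\mathbf{01}}\oplus i\,\overline{\mathbf{23}},\quad \overline{\mathbf{02}}\oplus i\,\overline{\mathbf{13}},\quad \overline{\mathbf{03}}\oplus i\,\overline{\mathbf{12}}$$ of the complex Clifford algebra $\mathcal{C}\!\ell^{\mathbb C}(p,q)$ are closed with respect to the anticommutator $U,V\mapsto\{U,V\}$, and form subalgebras of the Clifford algebra considered with respect to this operation.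
   Context: $\mathcal{C}\!\ell^{\mathbb F}(p,q)$ ($\mathbb F=\mathbb R$ or $\mathbb C$) is the Clifford algebra over $\mathbb F$ with identity $e$ and generators $e^1,\dots,e^n$, $n=p+q$, satisfying $e^ae^b+e^be^a=2\eta^{ab}e$, where $\eta$ is diagonal with $p$ entries $+1$ followed by $q$ entries $-1$. The $2^n$ elements $e$ and $e^{a_1\ldots a_k}=e^{a_1}\cdots e^{a_k}$ ($a_1<\dots<a_k$, $1\le k\le n$) form an $\mathbb F$-basis. $\mathcal{C}\!\ell^{\mathbb F}_k(p,q)$ is the $\mathbb F$-span of the basis elements with $k$ indices (rank $k$; $k=0$ means the span of $e$), and it is zero for $k>n$. We regard $\mathcal{C}\!\ell^{\mathbb R}(p,q)\subset\mathcal{C}\!\ell^{\mathbb C}(p,q)=\mathcal{C}\!\ell^{\mathbb R}(p,q)\oplus i\,\mathcal{C}\!\ell^{\mathbb R}(p,q)$. For $k\in\{0,1,2,3\}$, $\overline{\mathbf k}=\bigoplus_{j\equiv k \,(\mathrm{mod}\,4)}\mathcal{C}\!\ell^{\mathbb R}_j(p,q)$; $\overline{\mathbf{kl}}=\overline{\mathbf k}\oplus\overline{\mathbf l}$, and $\overline{\mathbf{0123}}=\mathcal{C}\!\ell^{\mathbb R}(p,q)$. All these are real vector spaces; subspaces and subalgebras inside $\mathcal{C}\!\ell^{\mathbb C}(p,q)$ are understood over $\mathbb R$. *)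

theory Defs
  imports Complex_Main "HOL-Library.Set_Algebras"
begin

text \<open>Diagonal metric: the first \<open>p\<close> diagonal entries are \<open>1\<close>, the remaining ones \<open>-1\<close>.\<close>

definition metric :: "nat \<Rightarrow> nat \<Rightarrow> nat \<Rightarrow> 'f::field" where
  "metric p a b = (if a \<noteq> b then 0 else if a \<le> p then 1 else - 1)"

text \<open>For \<open>A = {a\<^sub>1 < \<dots> < a\<^sub>k}\<close> this is \<open>e\<^bsup>a\<^sub>1\<^esup> \<cdots> e\<^bsup>a\<^sub>k\<^esup>\<close>; it is the identity for empty \<open>A\<close>.\<close>

definition basis_element :: "(nat \<Rightarrow> 'a::monoid_mult) \<Rightarrow> nat set \<Rightarrow> 'a" where
  "basis_element e A = prod_list (map e (sorted_list_of_set A))"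

text \<open>
  The elements \<open>e 1, \<dots>, e (p + q)\<close> of an associative unital \<open>'f\<close>-algebra \<open>'a\<close> generate a Clifford
  algebra of signature \<open>(p, q)\<close> over \<open>'f\<close>, which is then the span \<open>clifford_algebra\<close> below, of
  dimension \<open>2 ^ (p + q)\<close>. The ambient type \<open>'a\<close> may be larger than this span, so that a single type
  can host all signatures (see \<open>clifford_generators_exist\<close>).
\<close>

locale clifford_generators = vector_space scale
  for scale :: "'f::field \<Rightarrow> 'a::ring_1 \<Rightarrow> 'a" +
  fixes p q :: nat and e :: "nat \<Rightarrow> 'a"
  assumes scale_mult_left: "scale c x * y = scale c (x * y)"
    and scale_mult_right: "x * scale c y = scale c (x * y)"
    and clifford_relation:
      "a \<in> {1..p + q} \<Longrightarrow> b \<in> {1..p + q} \<Longrightarrow> e a * e b + e b * e a = scale (2 * metric p a b) 1"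
    and inj_basis: "inj_on (basis_element e) (Pow {1..p + q})"
    and independent_basis: "independent (basis_element e ` Pow {1..p + q})"

definition clifford_algebra :: "('f::field \<Rightarrow> 'a::ring_1 \<Rightarrow> 'a) \<Rightarrow> nat \<Rightarrow> (nat \<Rightarrow> 'a) \<Rightarrow> 'a set" where
  "clifford_algebra scale n e = module.span scale (basis_element e ` Pow {1..n})"

definition rank_subspace ::
    "('f::field \<Rightarrow> 'a::ring_1 \<Rightarrow> 'a) \<Rightarrow> nat \<Rightarrow> (nat \<Rightarrow> 'a) \<Rightarrow> nat \<Rightarrow> 'a set" where
  "rank_subspace scale n e k =
     module.span scale (basis_element e ` {A. A \<subseteq> {1..n} \<and> card A = k})"

text \<open>
  Real scalar multiplication of a complex algebra. With it, \<open>clifford_algebra\<close> and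
  \<open>rank_subspace\<close> yield the real Clifford algebra and its rank subspaces inside the complex one.
\<close>

definition real_restriction :: "(complex \<Rightarrow> 'a \<Rightarrow> 'a) \<Rightarrow> real \<Rightarrow> 'a \<Rightarrow> 'a" where
  "real_restriction scale r = scale (complex_of_real r)"

text \<open>
  The sum is the elementwise sum of sets; it is direct for \<open>clifford_generators\<close>, by linear
  independence of the basis. Ranks above \<open>n\<close> contribute only the zero subspace.
\<close>

definition mod4_subspace ::
    "(real \<Rightarrow> 'a::ring_1 \<Rightarrow> 'a) \<Rightarrow> nat \<Rightarrow> (nat \<Rightarrow> 'a) \<Rightarrow> nat \<Rightarrow> 'a set" where
  "mod4_subspace scale n e k = (\<Sum>j\<in>{j. j \<le> n \<and> j mod 4 = k}. rank_subspace scale n e j)"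

definition anticommutator :: "'a::ring_1 \<Rightarrow> 'a \<Rightarrow> 'a" where
  "anticommutator U V = U * V + V * U"

definition anticommutator_subalgebra ::
    "(real \<Rightarrow> 'a::ring_1 \<Rightarrow> 'a) \<Rightarrow> 'a set \<Rightarrow> 'a set \<Rightarrow> bool" where
  "anticommutator_subalgebra scale S C \<longleftrightarrow>
     S \<subseteq> C \<and> module.subspace scale S \<and> (\<forall>U\<in>S. \<forall>V\<in>S. anticommutator U V \<in> S)"


subsection \<open>Existence of Clifford algebras\<close>

text \<open>
  The Clifford algebra is realised by its left regular representation on coefficient families
  \<open>nat set \<Rightarrow> 'f\<close>.
\<close>

typedef (overloaded) ('f::field) coeff_op =
  "{T :: (nat set \<Rightarrow> 'f) \<Rightarrow> nat set \<Rightarrow> 'f.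
     \<forall>x y c. T (\<lambda>A. x A + c * y A) = (\<lambda>A. T x A + c * T y A)}"
  morphisms app Op
  by (rule exI[of _ "\<lambda>x. x"]) simp

setup_lifting type_definition_coeff_op

instantiation coeff_op :: (field) ring_1
begin

lift_definition zero_coeff_op :: "'a coeff_op" is "\<lambda>x A. 0" by simp
lift_definition one_coeff_op :: "'a coeff_op" is "\<lambda>x. x" by simp
lift_definition plus_coeff_op :: "'a coeff_op \<Rightarrow> 'a coeff_op \<Rightarrow> 'a coeff_op"
  is "\<lambda>S T x A. S x A + T x A" by (simp add: algebra_simps)
lift_definition minus_coeff_op :: "'a coeff_op \<Rightarrow> 'a coeff_op \<Rightarrow> 'a coeff_op"
  is "\<lambda>S T x A. S x A - T x A" by (simp add: algebra_simps)
lift_definition uminus_coeff_op :: "'a coeff_op \<Rightarrow> 'a coeff_op"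
  is "\<lambda>T x A. - T x A" by (simp add: algebra_simps)
lift_definition times_coeff_op :: "'a coeff_op \<Rightarrow> 'a coeff_op \<Rightarrow> 'a coeff_op"
  is "\<lambda>S T x. S (T x)" by simp

instance
proof
  fix a b c :: "'a coeff_op"
  have lin: "app a (\<lambda>A. x A + y A) = (\<lambda>A. app a x A + app a y A)" for a :: "'a coeff_op" and x y
  proof -
    have "app a (\<lambda>A. x A + c * y A) = (\<lambda>A. app a x A + c * app a y A)" for c
      using app[of a] by blast
    from this[of 1] show ?thesis by simp
  qed
  show "a * b * c = a * (b * c)" by transfer simp
  show "1 * a = a" "a * 1 = a" by (transfer; simp)+
  show "a + b + c = a + (b + c)" "a + b = b + a" "0 + a = a" "- a + a = 0" "a - b = a + - b"
    by (transfer; simp add: algebra_simps)+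
  show "(a + b) * c = a * c + b * c" by transfer simp
  show "a * (b + c) = a * b + a * c"
    by (simp add: app_inject[symmetric] times_coeff_op.rep_eq plus_coeff_op.rep_eq lin)
  have "(\<lambda>x A. 0::'a) (\<lambda>_. 1) {} \<noteq> (\<lambda>x. x) (\<lambda>_. 1) {}" by simp
  then show "(0::'a coeff_op) \<noteq> 1" by transfer metis
qed

end

lift_definition scale_op :: "'f::field \<Rightarrow> 'f coeff_op \<Rightarrow> 'f coeff_op"
  is "\<lambda>c T x A. c * T x A" by (simp add: algebra_simps)

definition toggle :: "nat \<Rightarrow> nat set \<Rightarrow> nat set" where
  "toggle a A = (if a \<in> A then A - {a} else insert a A)"

definition gen_coeff :: "nat \<Rightarrow> nat \<Rightarrow> nat set \<Rightarrow> 'f::field" where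
  "gen_coeff p a A = (- 1) ^ card {b\<in>A. b < a} * (if a \<in> A then 1 else metric p a a)"

lift_definition gen :: "nat \<Rightarrow> nat \<Rightarrow> 'f::field coeff_op"
  is "\<lambda>p a x A. gen_coeff p a A * x (toggle a A)" by (simp add: algebra_simps)

definition delta :: "nat set \<Rightarrow> nat set \<Rightarrow> 'f::field" where
  "delta B A = (if A = B then 1 else 0)"

lemma toggle_toggle: "toggle a (toggle a A) = A"
  by (auto simp: toggle_def)

lemma toggle_commute: "toggle a (toggle b A) = toggle b (toggle a A)"
  by (auto simp: toggle_def)

lemma gen_coeff_square: "gen_coeff p a A * gen_coeff p a (toggle a A) = (metric p a a :: 'f::field)"
proof -
  have "{b \<in> toggle a A. b < a} = {b\<in>A. b < a}" by (auto simp: toggle_def)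
  then show ?thesis
    by (auto simp: gen_coeff_def toggle_def simp flip: power_add)
qed

lemma gen_coeff_anticommute:
  assumes "a < b"
  shows "gen_coeff p b A * gen_coeff p a (toggle b A)
       = - (gen_coeff p a A * gen_coeff p b (toggle a A) :: 'f::field)"
proof -
  have fin: "finite {c\<in>A. c < b}" by (rule finite_subset[of _ "{..<b}"]) auto
  have 1: "{c \<in> toggle b A. c < a} = {c\<in>A. c < a}" using assms by (auto simp: toggle_def)
  have 2: "{c \<in> toggle a A. c < b} = (if a \<in> A then {c\<in>A. c < b} - {a} else insert a {c\<in>A. c < b})"
    using assms by (auto simp: toggle_def)
  have 3: "(- 1) ^ card {c \<in> toggle a A. c < b} = - ((- 1) ^ card {c\<in>A. c < b} :: 'f)"
  proof (cases "a \<in> A")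
    case True
    then have "card {c\<in>A. c < b} = Suc (card ({c\<in>A. c < b} - {a}))"
      using assms fin by (intro card.remove) auto
    then show ?thesis using True by (simp add: 2)
  next
    case False
    then show ?thesis using fin by (simp add: 2)
  qed
  have 4: "a \<in> toggle b A \<longleftrightarrow> a \<in> A" "b \<in> toggle a A \<longleftrightarrow> b \<in> A"
    using assms by (auto simp: toggle_def)
  show ?thesis by (simp add: gen_coeff_def 1 3 4 algebra_simps)
qed

lemma gen_relation:
  "gen p a * gen p b + gen p b * gen p a = scale_op (2 * metric p a b) (1 :: 'f::field coeff_op)"
proof -
  have "app (gen p a * gen p b + gen p b * gen p a) x A
      = app (scale_op (2 * metric p a b) (1 :: 'f coeff_op)) x A" for x A
  proof -
    have "app (gen p a * gen p b + gen p b * gen p a) x A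
      = (gen_coeff p a A * gen_coeff p b (toggle a A) + gen_coeff p b A * gen_coeff p a (toggle b A))
        * x (toggle a (toggle b A))"
      by (simp add: plus_coeff_op.rep_eq times_coeff_op.rep_eq gen.rep_eq toggle_commute[of b a]
        algebra_simps)
    also have "\<dots> = 2 * metric p a b * x A"
    proof (cases "a = b")
      case True
      then show ?thesis by (simp add: gen_coeff_square toggle_toggle)
    next
      case False
      then have "gen_coeff p a A * gen_coeff p b (toggle a A)
          + gen_coeff p b A * gen_coeff p a (toggle b A) = (0 :: 'f)"
        using gen_coeff_anticommute[of a b p A, where 'f = 'f]
          gen_coeff_anticommute[of b a p A, where 'f = 'f]
        by (metis add.commute eq_neg_iff_add_eq_0 linorder_neqE_nat)
      moreover have "metric p a b = (0 :: 'f)" using False by (simp add: metric_def)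
      ultimately show ?thesis by (simp only: mult_zero_left mult_zero_right)
    qed
    finally show ?thesis by (simp add: scale_op.rep_eq one_coeff_op.rep_eq)
  qed
  then show ?thesis by (simp add: app_inject[symmetric] fun_eq_iff)
qed

lemma gen_delta:
  assumes "\<forall>b\<in>B. a < b"
  shows "app (gen p a) (delta B) = (delta (insert a B) :: nat set \<Rightarrow> 'f::field)"
proof
  fix A
  have "a \<notin> B" using assms by auto
  then have "toggle a A = B \<longleftrightarrow> A = insert a B" by (auto simp: toggle_def)
  moreover have "gen_coeff p a (insert a B) = (1 :: 'f)"
  proof -
    have "{b \<in> insert a B. b < a} = {}" using assms by (auto dest: bspec)
    then have "card {b \<in> insert a B. b < a} = 0" by (simp only: card.empty)
    then show ?thesis unfolding gen_coeff_def by (simp only: power_0 insertI1 if_True mult_1)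
  qed
  ultimately show "app (gen p a) (delta B) A = (delta (insert a B) A :: 'f)"
    by (cases "A = insert a B") (simp_all add: gen.rep_eq delta_def)
qed

lemma basis_delta:
  assumes "finite A"
  shows "app (basis_element (gen p) A) (delta {}) = (delta A :: nat set \<Rightarrow> 'f::field)"
proof -
  have "sorted_wrt (<) xs \<Longrightarrow>
      app (prod_list (map (gen p) xs)) (delta {}) = (delta (set xs) :: nat set \<Rightarrow> 'f)" for xs
    by (induction xs) (simp_all add: one_coeff_op.rep_eq times_coeff_op.rep_eq gen_delta)
  from this[of "sorted_list_of_set A"] show ?thesis
    using assms by (simp add: basis_element_def)
qed

lemma app_sum: "app (\<Sum>i\<in>I. T i) x A = (\<Sum>i\<in>I. app (T i) x A)"
  by (induction I rule: infinite_finite_induct) (simp_all add: zero_coeff_op.rep_eq plus_coeff_op.rep_eq)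

theorem clifford_generators_exist:
  "clifford_generators (scale_op :: 'f::field \<Rightarrow> _) p q (gen p)"
proof -
  interpret vector_space "scale_op :: 'f \<Rightarrow> _"
    by unfold_locales (transfer; simp add: algebra_simps)+
  have fin: "finite A" if "A \<in> Pow {1..p + q}" for A using that by (auto intro: finite_subset)
  have inj: "inj_on (basis_element (gen p :: nat \<Rightarrow> 'f coeff_op)) (Pow {1..p + q})"
  proof (rule inj_onI)
    fix A B assume "A \<in> Pow {1..p + q}" "B \<in> Pow {1..p + q}"
      "basis_element (gen p) A = (basis_element (gen p) B :: 'f coeff_op)"
    then have "delta A A = (delta B A :: 'f)" by (metis basis_delta fin)
    then show "A = B" by (simp add: delta_def split: if_splits)
  qed
  have ind: "independent (basis_element (gen p :: nat \<Rightarrow> 'f coeff_op) ` Pow {1..p + q})"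
  proof (rule independent_if_scalars_zero)
    fix u :: "'f coeff_op \<Rightarrow> 'f" and x :: "'f coeff_op"
    assume s: "(\<Sum>x\<in>basis_element (gen p :: nat \<Rightarrow> 'f coeff_op) ` Pow {1..p + q}. scale_op (u x) x) = 0"
      and "x \<in> basis_element (gen p) ` Pow {1..p + q}"
    then obtain B where B: "B \<in> Pow {1..p + q}" "x = basis_element (gen p) B" by blast
    have "0 = app (\<Sum>A\<in>Pow {1..p + q}. scale_op (u (basis_element (gen p) A))
        (basis_element (gen p) A)) (delta {}) B"
      using s inj by (simp add: sum.reindex zero_coeff_op.rep_eq)
    also have "\<dots> = (\<Sum>A\<in>Pow {1..p + q}. u (basis_element (gen p) A) * delta A B)"
      unfolding app_sum by (rule sum.cong) (simp_all add: scale_op.rep_eq basis_delta fin)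
    also have "\<dots> = (\<Sum>A\<in>Pow {1..p + q}. if B = A then u (basis_element (gen p) A) else 0)"
      by (rule sum.cong) (auto simp: delta_def)
    also have "\<dots> = u x" using B by simp
    finally show "u x = 0" by simp
  qed simp
  show ?thesis
  proof unfold_locales
    fix c :: 'f and x y :: "'f coeff_op"
    show "scale_op c x * y = scale_op c (x * y)" by transfer simp
    have "app x (\<lambda>A. c * z A) = (\<lambda>A. c * app x z A)" for z
    proof -
      have lin: "app x (\<lambda>A. v A + d * w A) = (\<lambda>A. app x v A + d * app x w A)" for v w d
        using app[of x] by auto
      from lin[of "\<lambda>A. 0" "- 1" "\<lambda>A. 0"] have "app x (\<lambda>A. 0) = (\<lambda>A. 0)" by (simp add: fun_eq_iff)
      with lin[of "\<lambda>A. 0" c z] show ?thesis by simp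
    qed
    then show "x * scale_op c y = scale_op c (x * y)"
      by (simp add: app_inject[symmetric] times_coeff_op.rep_eq scale_op.rep_eq)
  qed (use inj ind gen_relation in auto)
qed

end

theory Submission
  imports Defs
begin

text \<open>
  For \<open>k = |A|\<close>, \<open>l = |B|\<close> and \<open>m = |A \<inter> B|\<close>, the product \<open>e\<^sub>A e\<^sub>B\<close> is \<open>\<plusminus>\<close> the basis
  element of the symmetric difference, which has \<open>k + l - 2 m\<close> indices, and
  \<open>e\<^sub>B e\<^sub>A = (-1)\<^bsup>k l + m\<^esup> e\<^sub>A e\<^sub>B\<close>. So the anticommutator vanishes unless \<open>m \<equiv> k l (mod 2)\<close>, and
  then its rank is \<open>k + l + 2 k l\<close> modulo 4. This operation on \<open>{0, 1, 2, 3}\<close> is the Klein four-group,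
  so the anticommutator is graded by it; over the complex numbers, together with the grading by
  powers of \<open>i\<close>, it is graded by the Klein group times the group of order 2. The listed subspaces
  correspond to subgroups of these groups.
\<close>

section \<open>Basis elements, their products and their grades modulo 4\<close>

lemma basis_element_empty: "basis_element e {} = 1"
  by (simp add: basis_element_def)

text \<open>A new minimum comes first in the sorted index list. The inductions over index sets below
  peel off one leading generator in this way.\<close>

lemma basis_element_insert_min:
  assumes "finite A" "\<forall>a\<in>A. b < a"
  shows "basis_element e (insert b A) = e b * basis_element e A"
proof -
  have "b \<notin> A" using assms by auto
  moreover have "insort b (sorted_list_of_set A) = b # sorted_list_of_set A"
    using assms by (intro insort_is_Cons) (auto simp: less_imp_le)
  ultimately show ?thesis
    using assms by (simp add: basis_element_def sorted_list_of_set_insert)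
qed

definition anticommutator_grade :: "nat \<Rightarrow> nat \<Rightarrow> nat" where
  "anticommutator_grade k l = (k + l + 2 * k * l) mod 4"

text \<open>A set of residues is used instead of a single one: sums of these subspaces become unions
  of sets, and closure under the anticommutator is reduced to a condition on \<open>K\<close>
  alone.\<close>

definition grade_subspace ::
    "('f::field \<Rightarrow> 'a::ring_1 \<Rightarrow> 'a) \<Rightarrow> nat \<Rightarrow> (nat \<Rightarrow> 'a) \<Rightarrow> nat set \<Rightarrow> 'a set" where
  "grade_subspace scale n e K =
     module.span scale (basis_element e ` {A. A \<subseteq> {1..n} \<and> card A mod 4 \<in> K})"

lemma clifford_algebra_eq_grade_subspace:
  "clifford_algebra scale n e = grade_subspace scale n e {0, 1, 2, 3}"
proof -
  have "k mod 4 \<in> {0, 1, 2, 3}" for k :: nat by auto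
  then show ?thesis
    unfolding clifford_algebra_def grade_subspace_def Pow_def by simp
qed

text \<open>The rank is \<open>k + l - 2 m\<close>, and evenness of \<open>k l + m\<close> makes
  \<open>- 2 m\<close> congruent to \<open>2 k l\<close> modulo 4. Writing
  \<open>k l + m = 2 t\<close> turns this into an equation without subtraction of natural
  numbers.\<close>

lemma even_card_sym_diff:
  assumes "finite A" "finite B" "even (card A * card B + card (A \<inter> B))"
  shows "card (sym_diff A B) mod 4 = anticommutator_grade (card A mod 4) (card B mod 4)"
proof -
  have "card (sym_diff A B) = card (A - B) + card (B - A)"
    using assms by (intro card_Un_disjoint) auto
  moreover have "card (A - B) + card (A \<inter> B) = card A" "card (B - A) + card (A \<inter> B) = card B"
    using assms by (metis card_Int_Diff add.commute, metis card_Int_Diff add.commute Int_commute)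
  moreover obtain t where "card A * card B + card (A \<inter> B) = 2 * t"
    using assms(3) by (elim evenE)
  ultimately have "card (sym_diff A B) + 4 * t = card A + card B + 2 * (card A * card B)"
    by linarith
  then have "card (sym_diff A B) mod 4 = (card A + card B + 2 * (card A * card B)) mod 4"
    by (metis mod_mult_self2)
  also have "\<dots> = anticommutator_grade (card A mod 4) (card B mod 4)"
    unfolding anticommutator_grade_def mult.assoc by (intro mod_add_cong mod_mult_cong) simp_all
  finally show ?thesis .
qed

text \<open>The conditions on the generators are stated in the ring alone, so they survive a change
  of scalars: the locale covers the real algebra, the complex algebra, and the complex algebra over
  the reals.\<close>

locale anticommuting_units = vector_space scale
  for scale :: "'f::field \<Rightarrow> 'a::ring_1 \<Rightarrow> 'a" +
  fixes n :: nat and e :: "nat \<Rightarrow> 'a"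
  assumes scale_mult_left: "scale c x * y = scale c (x * y)"
    and scale_mult_right: "x * scale c y = scale c (x * y)"
    and square: "a \<in> {1..n} \<Longrightarrow> e a * e a = 1 \<or> e a * e a = - 1"
    and anticommute: "a \<in> {1..n} \<Longrightarrow> b \<in> {1..n} \<Longrightarrow> a \<noteq> b \<Longrightarrow> e a * e b = - (e b * e a)"
begin

text \<open>The new generator is placed in front, is absorbed by the leading factor through its
  square, or moves past that factor with a sign.\<close>

lemma generator_mult_basis:
  assumes "finite B" "a \<in> {1..n}" "B \<subseteq> {1..n}"
  shows "e a * basis_element e B
    \<in> {basis_element e (toggle a B), - basis_element e (toggle a B)}"
  using assms
proof (induction B rule: finite_linorder_min_induct)
  case empty
  then show ?case
    by (simp add: toggle_def basis_element_insert_min[of "{}" a] basis_element_empty)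
next
  case (insert x B)
  have B: "basis_element e (insert x B) = e x * basis_element e B"
    using insert.hyps by (intro basis_element_insert_min) auto
  consider "a < x" | "a = x" | "x < a" by linarith
  then show ?case
  proof cases
    case 1
    then have "toggle a (insert x B) = insert a (insert x B)"
      using insert.hyps by (auto simp: toggle_def)
    moreover have "basis_element e (insert a (insert x B)) = e a * basis_element e (insert x B)"
      using 1 insert.hyps by (intro basis_element_insert_min) auto
    ultimately show ?thesis by simp
  next
    case 2
    then have "toggle a (insert x B) = B"
      using insert.hyps by (auto simp: toggle_def)
    moreover have "e a * basis_element e (insert x B) = e a * e a * basis_element e B"
      using 2 by (simp add: B mult.assoc)
    ultimately show ?thesis using square[of a] insert.prems by auto
  next
    case 3
    then have t: "toggle a (insert x B) = insert x (toggle a B)"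
      by (auto simp: toggle_def)
    have "basis_element e (insert x (toggle a B)) = e x * basis_element e (toggle a B)"
      using 3 insert.hyps by (intro basis_element_insert_min) (auto simp: toggle_def)
    moreover have "e a * basis_element e (insert x B) = - (e x * (e a * basis_element e B))"
      using 3 insert.prems anticommute[of a x] by (simp add: B flip: mult.assoc)
    moreover have "e a * basis_element e B
        \<in> {basis_element e (toggle a B), - basis_element e (toggle a B)}"
      using insert by auto
    ultimately show ?thesis by (auto simp: t)
  qed
qed

text \<open>Each generator of the left factor toggles its own index. These indices are distinct, so
  none is toggled back.\<close>

lemma basis_mult_basis:
  assumes "finite A" "A \<subseteq> {1..n}" "B \<subseteq> {1..n}"
  shows "basis_element e A * basis_element e B
    \<in> {basis_element e (sym_diff A B), - basis_element e (sym_diff A B)}"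
  using assms
proof (induction A rule: finite_linorder_min_induct)
  case empty
  then show ?case by (simp add: basis_element_empty)
next
  case (insert x A)
  let ?D = "sym_diff A B"
  have D: "?D \<subseteq> {1..n}" "finite ?D"
    using insert finite_subset[of B "{1..n}"] by auto
  have t: "toggle x ?D = sym_diff (insert x A) B"
    using insert.hyps by (auto simp: toggle_def)
  have "basis_element e (insert x A) * basis_element e B
      = e x * (basis_element e A * basis_element e B)"
    using insert.hyps by (simp add: basis_element_insert_min mult.assoc)
  moreover have "basis_element e A * basis_element e B \<in> {basis_element e ?D, - basis_element e ?D}"
    using insert by auto
  moreover have "e x * basis_element e ?D
      \<in> {basis_element e (toggle x ?D), - basis_element e (toggle x ?D)}"
    using insert.prems D by (intro generator_mult_basis) auto
  ultimately show ?case unfolding t by auto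
qed

text \<open>\<open>e a\<close> anticommutes with every factor except itself, so only the indices
  other than \<open>a\<close> contribute a sign.\<close>

lemma generator_commute_basis:
  assumes "finite B" "a \<in> {1..n}" "B \<subseteq> {1..n}"
  shows "e a * basis_element e B = (- 1) ^ card (B - {a}) * (basis_element e B * e a)"
  using assms
proof (induction B rule: finite_linorder_min_induct)
  case empty
  then show ?case by (simp add: basis_element_empty)
next
  case (insert x B)
  have B: "basis_element e (insert x B) = e x * basis_element e B"
    using insert.hyps by (intro basis_element_insert_min) auto
  have IH: "e a * basis_element e B = (- 1) ^ card (B - {a}) * (basis_element e B * e a)"
    using insert by auto
  have x: "x \<notin> B" using insert.hyps by auto
  \<comment> \<open>The sign is an element of a possibly noncommutative ring; it is central because
    it equals 1 or -1 according to the parity of \<open>k\<close>.\<close>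
  have comm: "e x * ((- 1) ^ k * y) = (- 1) ^ k * (e x * y)" for k y
    by (cases "even k") auto
  show ?case
  proof (cases "a = x")
    case True
    then have "insert x B - {a} = B - {a}" by auto
    \<comment> \<open>The extra factor is \<open>e a\<close> itself and stays in front; only the
      inner product is commuted.\<close>
    moreover have "e a * basis_element e (insert x B)
        = e a * ((- 1) ^ card (B - {a}) * (basis_element e B * e a))"
      unfolding IH[symmetric] using True by (simp add: B)
    ultimately show ?thesis using True by (simp only: B comm mult.assoc)
  next
    case False
    then have "insert x B - {a} = insert x (B - {a})" by auto
    then have c: "card (insert x B - {a}) = Suc (card (B - {a}))"
      using x insert.hyps by simp
    have "e a * basis_element e (insert x B) = - (e x * (e a * basis_element e B))"
      using False insert.prems anticommute[of a x] by (simp add: B flip: mult.assoc)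
    also have "\<dots> = (- 1) ^ card (insert x B - {a}) * (basis_element e (insert x B) * e a)"
      by (simp add: c B IH comm mult.assoc)
    finally show ?thesis .
  qed
qed

text \<open>An index of \<open>A\<close> contributes \<open>card B\<close> signs, or one fewer if it
  lies in \<open>B\<close>. The total \<open>card A * card B - card (A \<inter> B)\<close> has the
  same parity as the exponent, whose plus sign avoids natural subtraction.\<close>

lemma basis_commute_basis:
  assumes "finite A" "A \<subseteq> {1..n}" "B \<subseteq> {1..n}"
  shows "basis_element e A * basis_element e B
    = (- 1) ^ (card A * card B + card (A \<inter> B)) * (basis_element e B * basis_element e A)"
  using assms
proof (induction A rule: finite_linorder_min_induct)
  case empty
  then show ?case by (simp add: basis_element_empty)
next
  case (insert x A)
  let ?m = "card A * card B + card (A \<inter> B)"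
  have finB: "finite B" using insert.prems finite_subset[of B "{1..n}"] by auto
  have x: "x \<notin> A" using insert.hyps by auto
  have A: "basis_element e (insert x A) = e x * basis_element e A"
    using insert.hyps by (intro basis_element_insert_min) auto
  have comm: "e x * ((- 1) ^ k * y) = (- 1) ^ k * (e x * y)" for k y
    by (cases "even k") auto
  have "basis_element e (insert x A) * basis_element e B
      = (- 1) ^ ?m * (e x * basis_element e B * basis_element e A)"
    using insert by (simp add: A mult.assoc comm)
  also have "\<dots> = (- 1) ^ (?m + card (B - {x})) * (basis_element e B * basis_element e (insert x A))"
    using insert.prems finB by (simp add: generator_commute_basis A power_add mult.assoc)
  \<comment> \<open>For \<open>x\<close> in \<open>B\<close> the two exponents differ by 2: one
    index is missing from \<open>B - {x}\<close>, while the intersection grows by one. Only the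
    parity matters.\<close>
  also have "(- 1) ^ (?m + card (B - {x})) =
      ((- 1) ^ (card (insert x A) * card B + card (insert x A \<inter> B)) :: 'a)"
  proof -
    have "even (?m + card (B - {x})) \<longleftrightarrow>
        even (card (insert x A) * card B + card (insert x A \<inter> B))"
    proof (cases "x \<in> B")
      case True
      then have "card B = Suc (card (B - {x}))" using finB by (intro card.remove)
      then show ?thesis using True x insert.hyps by simp presburger
    next
      case False
      then show ?thesis using x insert.hyps by simp presburger
    qed
    then show ?thesis by (simp add: minus_one_power_iff)
  qed
  finally show ?case .
qed

section \<open>Grading of the anticommutator\<close>

lemma anticommutator_basis_in_grade_subspace:
  assumes "A \<subseteq> {1..n}" "B \<subseteq> {1..n}"
    and "anticommutator_grade (card A mod 4) (card B mod 4) \<in> M"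
  shows "anticommutator (basis_element e A) (basis_element e B) \<in> grade_subspace scale n e M"
proof -
  let ?m = "card A * card B + card (A \<inter> B)"
  have fin: "finite A" "finite B" using assms finite_subset by blast+
  show ?thesis
  proof (cases "even ?m")
    case True
    have "basis_element e (sym_diff A B) \<in> grade_subspace scale n e M"
      unfolding grade_subspace_def
      using assms even_card_sym_diff[OF fin True] by (intro span_base) auto
    then have "basis_element e A * basis_element e B \<in> grade_subspace scale n e M"
      using basis_mult_basis[OF fin(1) assms(1,2)]
      unfolding grade_subspace_def by (auto intro: span_neg)
    moreover have "basis_element e A * basis_element e B = basis_element e B * basis_element e A"
      using basis_commute_basis[OF fin(1) assms(1,2)] True by simp
    ultimately show ?thesis
      unfolding anticommutator_def grade_subspace_def by (auto intro: span_add)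
  next
    case False
    then have "basis_element e A * basis_element e B = - (basis_element e B * basis_element e A)"
      using basis_commute_basis[OF fin(1) assms(1,2)] by simp
    then show ?thesis
      by (simp add: anticommutator_def grade_subspace_def span_zero)
  qed
qed

lemma subspace_grade_subspace: "subspace (grade_subspace scale n e K)"
  by (simp add: grade_subspace_def subspace_span)

text \<open>Bilinear extension from basis elements, first in \<open>V\<close> with a basis element
  on the left, then in \<open>U\<close>. Three separate residue sets are allowed so that mixed
  products of real and imaginary parts are covered too.\<close>

lemma anticommutator_in_grade_subspace:
  assumes U: "U \<in> grade_subspace scale n e K" and V: "V \<in> grade_subspace scale n e L"
    and M: "\<And>k l. k \<in> K \<Longrightarrow> l \<in> L \<Longrightarrow> anticommutator_grade k l \<in> M"
  shows "anticommutator U V \<in> grade_subspace scale n e M"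
proof -
  let ?M = "grade_subspace scale n e M"
  note sub = subspace_grade_subspace[of M]
  have *: "anticommutator (basis_element e A) V \<in> ?M" if "A \<subseteq> {1..n}" "card A mod 4 \<in> K" for A
    using V unfolding grade_subspace_def[of _ _ _ L]
  proof (induction V rule: span_induct_alt)
    case base
    then show ?case using subspace_0[OF sub] by (simp add: anticommutator_def)
  next
    case (step c x y)
    then have "anticommutator (basis_element e A) x \<in> ?M"
      using that M by (blast intro: anticommutator_basis_in_grade_subspace)
    moreover have "anticommutator (basis_element e A) (scale c x + y)
        = scale c (anticommutator (basis_element e A) x) + anticommutator (basis_element e A) y"
      by (simp add: anticommutator_def algebra_simps scale_mult_left scale_mult_right scale_right_distrib)
    ultimately show ?case using step by (simp add: subspace_add[OF sub] subspace_scale[OF sub])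
  qed
  show ?thesis
    using U unfolding grade_subspace_def[of _ _ _ K]
  proof (induction U rule: span_induct_alt)
    case base
    then show ?case using subspace_0[OF sub] by (simp add: anticommutator_def)
  next
    case (step c x y)
    then have "anticommutator x V \<in> ?M" using * by auto
    moreover have "anticommutator (scale c x + y) V
        = scale c (anticommutator x V) + anticommutator y V"
      by (simp add: anticommutator_def algebra_simps scale_mult_left scale_mult_right scale_right_distrib)
    ultimately show ?case using step by (simp add: subspace_add[OF sub] subspace_scale[OF sub])
  qed
qed

section \<open>Sums of spans and change of scalars\<close>

lemma span_plus_span: "span S + span T = span (S \<union> T)"
  unfolding span_Un by (auto simp: set_plus_def)

lemma sum_span: "finite I \<Longrightarrow> (\<Sum>i\<in>I. span (S i)) = span (\<Union>i\<in>I. S i)"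
  by (induction I rule: finite_induct) (simp_all add: span_plus_span set_zero)

lemma grade_subspace_plus:
  "grade_subspace scale n e K + grade_subspace scale n e L = grade_subspace scale n e (K \<union> L)"
  unfolding grade_subspace_def span_plus_span
  by (rule arg_cong[where f = span]) auto

lemma grade_subspace_mono:
  "K \<subseteq> L \<Longrightarrow> grade_subspace scale n e K \<subseteq> grade_subspace scale n e L"
  unfolding grade_subspace_def by (intro span_mono) auto

end

text \<open>A subset of \<open>{1..n}\<close> has at most \<open>n\<close> elements, so the bound on
  \<open>j\<close> omits no basis element, and a sum of spans is the span of the union.\<close>

lemma mod4_subspace_eq_grade_subspace:
  assumes "anticommuting_units s n e"
  shows "mod4_subspace s n e k = grade_subspace s n e {k}"
proof -
  interpret anticommuting_units s n e by fact
  have "card A \<le> n" if "A \<subseteq> {1..n}" for A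
    using card_mono[OF _ that] by simp
  then have "(\<Union>j\<in>{j. j \<le> n \<and> j mod 4 = k}. basis_element e ` {A. A \<subseteq> {1..n} \<and> card A = j})
      = basis_element e ` {A. A \<subseteq> {1..n} \<and> card A mod 4 \<in> {k}}"
    by auto
  then show ?thesis
    unfolding mod4_subspace_def rank_subspace_def grade_subspace_def by (simp add: sum_span)
qed

text \<open>The relation at equal indices determines only twice the square; characteristic 0 permits
  division by 2.\<close>

lemma anticommuting_units_clifford_generators:
  fixes scale :: "'f::field_char_0 \<Rightarrow> 'a::ring_1 \<Rightarrow> 'a"
  assumes "clifford_generators scale p q e"
  shows "anticommuting_units scale (p + q) e"
proof -
  interpret clifford_generators scale p q e by fact
  show ?thesis
  proof unfold_locales
    fix a assume a: "a \<in> {1..p + q}"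
    have "scale 2 (e a * e a) = e a * e a + e a * e a"
      using scale_left_distrib[of 1 1 "e a * e a"] by simp
    also have "\<dots> = scale 2 (scale (metric p a a) 1)"
      using clifford_relation[OF a a] by simp
    finally have "e a * e a = scale (metric p a a) 1"
      by (simp only: scale_left_imp_eq[of 2] scale_cancel_left) simp
    then show "e a * e a = 1 \<or> e a * e a = - 1"
      by (simp add: metric_def split: if_splits)
  next
    fix a b assume "a \<in> {1..p + q}" "b \<in> {1..p + q}" "a \<noteq> b"
    then have "e a * e b + e b * e a = 0"
      using clifford_relation[of a b] by (simp add: metric_def)
    then show "e a * e b = - (e b * e a)" by (simp add: eq_neg_iff_add_eq_0)
  qed (simp_all add: scale_mult_left scale_mult_right)
qed

lemma anticommuting_units_real_restriction:
  assumes "anticommuting_units scale n e"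
  shows "anticommuting_units (real_restriction scale) n e"
proof -
  interpret anticommuting_units scale n e by fact
  show ?thesis
    by unfold_locales
      (simp_all add: real_restriction_def scale_left_distrib scale_right_distrib
        scale_mult_left scale_mult_right square, rule anticommute, simp_all)
qed

section \<open>Subalgebras from closed sets of residues\<close>

lemma anticommutator_subalgebra_grade_subspace:
  assumes "anticommuting_units s n e" and "grade_subspace s n e K \<subseteq> C"
    and "\<forall>k\<in>K. \<forall>l\<in>K. anticommutator_grade k l \<in> K"
  shows "anticommutator_subalgebra s (grade_subspace s n e K) C"
proof -
  interpret anticommuting_units s n e by fact
  show ?thesis
    using assms subspace_grade_subspace anticommutator_in_grade_subspace
    unfolding anticommutator_subalgebra_def by blast
qed

text \<open>For \<open>U = u + i u'\<close> and \<open>V = v + i v'\<close> the anticommutator has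
  real part \<open>{u, v} - {u', v'}\<close> and imaginary part \<open>{u, v'} + {u', v}\<close>.
  This yields the three conditions; the remaining pairing of \<open>L\<close> with \<open>K\<close>
  follows by symmetry.\<close>

lemma anticommutator_subalgebra_complex_grade_subspace:
  assumes "anticommuting_units scale n e"
    and KK: "\<forall>k\<in>K. \<forall>l\<in>K. anticommutator_grade k l \<in> K"
    and LL: "\<forall>k\<in>L. \<forall>l\<in>L. anticommutator_grade k l \<in> K"
    and KL: "\<forall>k\<in>K. \<forall>l\<in>L. anticommutator_grade k l \<in> L"
  defines "s \<equiv> real_restriction scale"
  shows "anticommutator_subalgebra s
    (grade_subspace s n e K + scale \<i> ` grade_subspace s n e L) (clifford_algebra scale n e)"
    (is "anticommutator_subalgebra s (?K + scale \<i> ` ?L) ?C")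
proof -
  interpret C: anticommuting_units scale n e by fact
  interpret R: anticommuting_units s n e
    unfolding s_def by (rule anticommuting_units_real_restriction) fact
  have CC: "C.subspace ?C"
    by (simp add: clifford_algebra_def C.subspace_span)
  \<comment> \<open>A complex subspace is also a real one, so the real span of basis elements stays
    inside their complex span.\<close>
  have sub: "grade_subspace s n e M \<subseteq> ?C" for M
    unfolding grade_subspace_def
  proof (rule R.span_minimal)
    show "basis_element e ` {A. A \<subseteq> {1..n} \<and> card A mod 4 \<in> M} \<subseteq> ?C"
      unfolding clifford_algebra_def by (auto intro!: C.span_base)
    show "R.subspace ?C"
      using CC unfolding R.subspace_def C.subspace_def by (simp add: s_def real_restriction_def)
  qed
  have "?K + scale \<i> ` ?L \<subseteq> ?C"
    using sub[of K] sub[of L]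
    by (auto simp: set_plus_def intro!: C.subspace_add[OF CC] C.subspace_scale[OF CC])
  moreover have "R.subspace (?K + scale \<i> ` ?L)"
  proof -
    \<comment> \<open>Multiplication by i is real linear, so it maps real subspaces to real
      subspaces; a sum of two subspaces is then the span of their union.\<close>
    have "module_hom s s (scale \<i>)"
      by unfold_locales (simp_all add: s_def real_restriction_def C.scale_right_distrib mult.commute)
    then have "R.subspace (scale \<i> ` ?L)"
      using R.subspace_grade_subspace by (rule module_hom.subspace_image)
    then have "R.span (scale \<i> ` ?L) = scale \<i> ` ?L" "R.span ?K = ?K"
      using R.subspace_grade_subspace by (simp_all add: R.span_eq_iff)
    then show ?thesis by (metis R.span_plus_span R.subspace_span)
  qed
  moreover have "anticommutator U V \<in> ?K + scale \<i> ` ?L"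
    if UV: "U \<in> ?K + scale \<i> ` ?L" "V \<in> ?K + scale \<i> ` ?L" for U V
  proof -
    obtain u u' where U: "U = u + scale \<i> u'" "u \<in> ?K" "u' \<in> ?L"
      using UV(1) by (auto simp: set_plus_def)
    obtain v v' where V: "V = v + scale \<i> v'" "v \<in> ?K" "v' \<in> ?L"
      using UV(2) by (auto simp: set_plus_def)
    have comm: "anticommutator u' v = anticommutator v u'"
      by (simp add: anticommutator_def add.commute)
    have "anticommutator u v \<in> ?K" "anticommutator u' v' \<in> ?K"
      "anticommutator u v' \<in> ?L" "anticommutator u' v \<in> ?L"
      unfolding comm using U V KK LL KL by (auto intro: R.anticommutator_in_grade_subspace)
    then have "anticommutator u v - anticommutator u' v' \<in> ?K"
      "anticommutator u v' + anticommutator u' v \<in> ?L"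
      by (simp_all add: R.subspace_diff R.subspace_add R.subspace_grade_subspace)
    moreover have "anticommutator U V = (anticommutator u v - anticommutator u' v')
        + scale \<i> (anticommutator u v' + anticommutator u' v)"
      by (simp add: U V anticommutator_def algebra_simps C.scale_mult_left C.scale_mult_right
        C.scale_right_distrib)
    ultimately show ?thesis by (auto simp: set_plus_def)
  qed
  ultimately show ?thesis unfolding anticommutator_subalgebra_def by blast
qed

theorem theorem3:
  fixes p q :: nat
    and sR :: "real \<Rightarrow> 'a::ring_1 \<Rightarrow> 'a" and eR :: "nat \<Rightarrow> 'a"
    and sC :: "complex \<Rightarrow> 'b::ring_1 \<Rightarrow> 'b" and eC :: "nat \<Rightarrow> 'b"
  assumes "p + q \<ge> 1"
    and "clifford_generators sR p q eR"
    and "clifford_generators sC p q eC"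
  shows
    "(let Q = mod4_subspace sR (p + q) eR
      in \<forall>S \<in> {Q 0, Q 0 + Q 1, Q 0 + Q 2, Q 0 + Q 3}.
           anticommutator_subalgebra sR S (clifford_algebra sR (p + q) eR))
   \<and> (let s = real_restriction sC;
          Q = mod4_subspace s (p + q) eC;
          I = (\<lambda>S. sC \<i> ` S)
      in \<forall>S \<in> {Q 0, Q 0 + Q 1, Q 0 + Q 2, Q 0 + Q 3, clifford_algebra s (p + q) eC,
               (Q 0 + Q 1) + I (Q 0 + Q 1), (Q 0 + Q 2) + I (Q 0 + Q 2), (Q 0 + Q 3) + I (Q 0 + Q 3),
               Q 0 + I (Q 0), Q 0 + I (Q 1), Q 0 + I (Q 2), Q 0 + I (Q 3),
               (Q 0 + Q 1) + I (Q 2 + Q 3), (Q 0 + Q 2) + I (Q 1 + Q 3), (Q 0 + Q 3) + I (Q 1 + Q 2)}.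
           anticommutator_subalgebra s S (clifford_algebra sC (p + q) eC))"
proof -
  note R = anticommuting_units_clifford_generators[OF assms(2)]
  note C = anticommuting_units_clifford_generators[OF assms(3)]
  note CR = anticommuting_units_real_restriction[OF C]
  let ?s = "real_restriction sC"
  let ?G = "grade_subspace ?s (p + q) eC"
  \<comment> \<open>The whole algebra is the grade subspace of all four residues, so the bound on
    \<open>K\<close> gives the inclusion by monotonicity.\<close>
  have a: "anticommutator_subalgebra sR (grade_subspace sR (p + q) eR K)
      (clifford_algebra sR (p + q) eR)"
    if "\<forall>k\<in>K. \<forall>l\<in>K. anticommutator_grade k l \<in> K" "K \<subseteq> {0, 1, 2, 3}" for K
    unfolding clifford_algebra_eq_grade_subspace
    by (rule anticommutator_subalgebra_grade_subspace
        [OF R anticommuting_units.grade_subspace_mono[OF R that(2)] that(1)])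
  note b = anticommutator_subalgebra_complex_grade_subspace[OF C]
  interpret anticommuting_units ?s "p + q" eC by (fact CR)
  interpret C: anticommuting_units sC "p + q" eC by (fact C)
  \<comment> \<open>The spaces without an imaginary part are the case \<open>L = {}\<close>, where
    the imaginary summand is the zero subspace.\<close>
  have I0: "sC \<i> ` ?G {} = 0"
    by (simp add: grade_subspace_def set_zero)
  have b0: "anticommutator_subalgebra ?s (?G K) (clifford_algebra sC (p + q) eC)"
    if "\<forall>k\<in>K. \<forall>l\<in>K. anticommutator_grade k l \<in> K" for K
    using b[of K "{}"] that by (simp add: I0)
  show ?thesis
    unfolding Let_def mod4_subspace_eq_grade_subspace[OF R]
      mod4_subspace_eq_grade_subspace[OF CR]
      anticommuting_units.grade_subspace_plus[OF R] grade_subspace_plus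
      clifford_algebra_eq_grade_subspace[of ?s]
    \<comment> \<open>Every space now is the grade subspace of some \<open>K\<close>, or such a
      subspace plus i times that of some \<open>L\<close>; what remains are finite checks of the
      operation on these residues.\<close>
    by (simp only: ball_simps, intro conjI TrueI)
      (rule a b0 b; simp add: anticommutator_grade_def)+
qed

end
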